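(* Let $\bm z^{(0)}\in\mathbb{C}^{n^2}$ and suppose that for every $j\ge0$ the point $\bm z^{(j+1)}$ is a global minimum over $\mathbb{C}^{n^2}$ of the quadratic surrogate $\bm z\mapsto\widetilde\Phi(\bm z;\bm z^{(j)})$ defined in the context. Then for all $j=0,1,\dots$, $$\Phi(\bm z^{(j+1)})\le\Phi(\bm z^{(j)}).$$ Additionally, $$\Phi(\bm z^{(j+1)})=\Phi(\bm z^{(j)})\ \Longrightarrow\ \nabla_{\bm z}\Phi(\bm z^{(j+1)})=0.$$
   Context: Setting. $n,m,N$ are positive integers; $\bm Q\in\mathbb{C}^{m^2}$ (the probe); for $k=1,\dots,N$, $P_k\in\{0,1\}^{m^2\times n^2}$ extracts the $k$-th scanning region (each row has exactly one entry $1$, in distinct columns for distinct rows), and $\bm d_k\in\mathbb{R}^{m^2}$ is a data vector with nonnegative entries. $\mathcal F:\mathbb{C}^{m^2}\to\mathbb{C}^{m^2}$ is the (unnormalized) two-dimensional discrete Fourier transform on vectorized $m\times m$ arrays, so $\|\mathcal F\bm v\|_2^2=m^2\|\bm v\|_2^2$. $\odot$ is the entrywise product; $|\cdot|$, $\sqrt{\cdot}$, $\exp$ and the principal argument $\theta$ act entrywise. Write $\bm z_k=P_k\bm z$. Revised exit wave: $\mathcal R_k(\bm z_k)=\mathcal F^{-1}\big(\sqrt{\bm d_k}\odot\exp(i\theta(\mathcal F(\bm Q\odot\bm z_k)))\big)$. Convention at zeros: if $[\mathcal F(\bm Q\odot\bm z_k)]_r=0$, the angle $[\theta(\mathcal F(\bm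 Q\odot\bm z_k))]_r$ is set to $0$ for a general point $\bm z$; for an iterate $\bm z^{(j)}$ it is set to $0$ if $j=0$, and if $j\ge1$ it is set to the value of the angle used at index $r$ for $\bm z^{(j-1)}$ (recursively). Objective: $\Phi(\bm z)=\frac12\sum_{k=1}^N\|\bm Q\odot P_k\bm z-\mathcal R_k(P_k\bm z)\|_2^2$. Surrogate: $\widetilde\Phi(\bm z;\bm z^{(j)})=\frac12\sum_{k=1}^N\|\bm Q\odot P_k\bm z-\mathcal R_k(P_k\bm z^{(j)})\|_2^2$. Complex gradient: for real-valued $f$ of $\bm z=\bm x+i\bm y$ ($\bm x,\bm y$ real), $\nabla_{\bm z}f=\nabla_{\bm x}f+i\nabla_{\bm y}f$. At an iterate $\bm z^{(j)}$ where $\Phi$ is not real-differentiable, the symbol $\nabla_{\bm z}\Phi(\bm z^{(j)})$ denotes $\sum_{k=1}^N P_k^\top\big(\overline{\bm Q}\odot(\bm Q\odot P_k\bm z^{(j)}-\mathcal R_k(P_k\bm z^{(j)}))\big)$, where in $\mathcal R_k(P_k\bm z^{(j)})$, whenever $[\mathcal F(\bm Q\odot P_k\bm z^{(j)})]_r=0$, the angle $[\theta(\mathcal F(\bm Q\odot P_k\bm z^{(j)}))]_r$ is taken to be $0$ if $j=0$ and, if $j\ge1$, the value of the angle used at index $r$ for $\bm z^{(j-1)}$ (recursively). *)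

theory Defs
  imports "HOL-Analysis.Analysis"
begin

(* An index type 'p with m^2 elements labels the entries of a vectorized m x m array. The map
   g :: 'p => nat * nat is the vectorization convention (row-major, column-major, ...): entry r of
   the vector is the array entry at position g r, counted from 0. Multiplication of vectors is the
   library's entrywise product. *)

definition vectorization :: "nat \<Rightarrow> ('p::finite \<Rightarrow> nat \<times> nat) \<Rightarrow> bool" where
  "vectorization m g \<longleftrightarrow> bij_betw g UNIV ({..<m} \<times> {..<m})"

definition dft2 :: "nat \<Rightarrow> ('p::finite \<Rightarrow> nat \<times> nat) \<Rightarrow> complex ^ 'p \<Rightarrow> complex ^ 'p" where
  "dft2 m g v = (\<chi> r. \<Sum>s\<in>UNIV. v $ s *
     exp (- (2 * of_real pi * \<i> *
       of_nat (fst (g r) * fst (g s) + snd (g r) * snd (g s)) / of_nat m)))"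

(* dft2 is bijective whenever vectorization m g holds, so this is its two-sided inverse. *)
definition inv_dft2 :: "nat \<Rightarrow> ('p::finite \<Rightarrow> nat \<times> nat) \<Rightarrow> complex ^ 'p \<Rightarrow> complex ^ 'p" where
  "inv_dft2 m g = inv (dft2 m g)"

definition scanning_matrix :: "complex ^ 'q ^ 'p \<Rightarrow> bool" where
  "scanning_matrix A \<longleftrightarrow>
     (\<forall>r c. A $ r $ c \<in> {0, 1}) \<and>
     (\<forall>r. \<exists>!c. A $ r $ c = 1) \<and>
     (\<forall>r r' c. A $ r $ c = 1 \<and> A $ r' $ c = 1 \<longrightarrow> r = r')"

(* Entrywise principal argument; psi supplies the angle at the entries that vanish. *)
definition angle :: "real ^ 'p \<Rightarrow> complex ^ 'p \<Rightarrow> real ^ 'p" where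
  "angle psi v = (\<chi> r. if v $ r = 0 then psi $ r else Arg (v $ r))"

(* R_k(w) for the data vector dk, with angles psi at the zeros of F(Q w). *)
definition exit_wave ::
  "nat \<Rightarrow> ('p::finite \<Rightarrow> nat \<times> nat) \<Rightarrow> complex ^ 'p \<Rightarrow> real ^ 'p \<Rightarrow> real ^ 'p
    \<Rightarrow> complex ^ 'p \<Rightarrow> complex ^ 'p" where
  "exit_wave m g Q dk psi w =
     inv_dft2 m g (\<chi> r. of_real (sqrt (dk $ r)) *
       exp (\<i> * of_real (angle psi (dft2 m g (Q * w)) $ r)))"

(* The surrogate in w around the point u; psi k are the angles at the zeros of F(Q P_k u). *)
definition surrogate ::
  "nat \<Rightarrow> ('p::finite \<Rightarrow> nat \<times> nat) \<Rightarrow> complex ^ 'p \<Rightarrow> nat \<Rightarrow> (nat \<Rightarrow> complex ^ 'q ^ 'p)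
    \<Rightarrow> (nat \<Rightarrow> real ^ 'p) \<Rightarrow> (nat \<Rightarrow> real ^ 'p) \<Rightarrow> complex ^ 'q \<Rightarrow> complex ^ 'q \<Rightarrow> real" where
  "surrogate m g Q N P d psi u w =
     1 / 2 * (\<Sum>k=1..N. (norm (Q * (P k *v w) - exit_wave m g Q (d k) (psi k) (P k *v u)))\<^sup>2)"

(* psi = (\<lambda>k. 0) is the convention for a general point. *)
definition objective ::
  "nat \<Rightarrow> ('p::finite \<Rightarrow> nat \<times> nat) \<Rightarrow> complex ^ 'p \<Rightarrow> nat \<Rightarrow> (nat \<Rightarrow> complex ^ 'q ^ 'p)
    \<Rightarrow> (nat \<Rightarrow> real ^ 'p) \<Rightarrow> (nat \<Rightarrow> real ^ 'p) \<Rightarrow> complex ^ 'q \<Rightarrow> real" where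
  "objective m g Q N P d psi w =
     1 / 2 * (\<Sum>k=1..N. (norm (Q * (P k *v w) - exit_wave m g Q (d k) (psi k) (P k *v w)))\<^sup>2)"

(* zero_angle m g Q P z j k: the angles to be used at the zeros of F(Q P_k z_j), namely 0 for
   j = 0 and otherwise the angles that were used (at zeros and non-zeros alike) for z_(j-1). *)
primrec zero_angle ::
  "nat \<Rightarrow> ('p::finite \<Rightarrow> nat \<times> nat) \<Rightarrow> complex ^ 'p \<Rightarrow> (nat \<Rightarrow> complex ^ 'q ^ 'p)
    \<Rightarrow> (nat \<Rightarrow> complex ^ 'q) \<Rightarrow> nat \<Rightarrow> nat \<Rightarrow> real ^ 'p" where
  "zero_angle m g Q P z 0 = (\<lambda>k. 0)"
| "zero_angle m g Q P z (Suc j) =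
     (\<lambda>k. angle (zero_angle m g Q P z j k) (dft2 m g (Q * (P k *v z j))))"

(* grad_x f + i grad_y f for z = x + i y; axis c 1 and axis c \<i> are the directions of the
   real coordinates x_c and y_c. *)
definition complex_gradient :: "(complex ^ 'q \<Rightarrow> real) \<Rightarrow> complex ^ 'q \<Rightarrow> complex ^ 'q" where
  "complex_gradient f z =
     (\<chi> c. of_real (frechet_derivative f (at z) (axis c 1)) +
           \<i> * of_real (frechet_derivative f (at z) (axis c \<i>)))"

(* The symbol grad Phi(z_j). Differentiability is over the reals, of Phi as a function on C^(n^2). *)
definition iterate_gradient ::
  "nat \<Rightarrow> ('p::finite \<Rightarrow> nat \<times> nat) \<Rightarrow> complex ^ 'p \<Rightarrow> nat \<Rightarrow> (nat \<Rightarrow> complex ^ 'q ^ 'p)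
    \<Rightarrow> (nat \<Rightarrow> real ^ 'p) \<Rightarrow> (nat \<Rightarrow> complex ^ 'q) \<Rightarrow> nat \<Rightarrow> complex ^ 'q" where
  "iterate_gradient m g Q N P d z j =
     (if objective m g Q N P d (\<lambda>k. 0) differentiable (at (z j))
      then complex_gradient (objective m g Q N P d (\<lambda>k. 0)) (z j)
      else \<Sum>k=1..N. transpose (P k) *v
             ((\<chi> r. cnj (Q $ r)) *
              (Q * (P k *v z j) -
               exit_wave m g Q (d k) (zero_angle m g Q P z j k) (P k *v z j))))"

end

theory Submission
  imports Defs
begin

text \<open>
  Let \<open>v = F(Q w)\<close> and let \<open>p\<close>, \<open>q\<close> be the vectors of unit phases that
  are used at \<open>w\<close> and at the centre \<open>u\<close> of the surrogate. By Parseval the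
  squared residual of the surrogate is, up to the factor \<open>m\<^sup>2\<close>, the sum of the
  \<open>\<bar>v\<^sub>r - \<surd>d\<^sub>r q\<^sub>r\<bar>\<^sup>2\<close>. Since \<open>v\<^sub>r = \<bar>v\<^sub>r\<bar> p\<^sub>r\<close>, each of these terms equals
  \<open>(\<bar>v\<^sub>r\<bar> - \<surd>d\<^sub>r)\<^sup>2 + \<bar>v\<^sub>r\<bar> \<surd>d\<^sub>r \<bar>p\<^sub>r - q\<^sub>r\<bar>\<^sup>2\<close>. Hence the surrogate is the objective
  plus a nonnegative gap (\<open>surrogate_eq_objective_plus_gap\<close>), which is zero when
  \<open>w\<close> is the centre. This is the situation of a majorize-minimize step: minimizing the
  surrogate cannot increase the objective.

  If the objective does not change, then the gap is zero at the new iterate, so the objective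
  and the surrogate agree there. For the gradient there are two cases.

  Where the objective is differentiable, it lies below the surrogate and touches it at a
  minimum of the surrogate; both derivatives vanish
  (\<open>derivative_zero_below_touching_minimum\<close>).

  Elsewhere the gradient is given by the formula with the inherited angles. A zero gap forces
  \<open>p\<^sub>r = q\<^sub>r\<close> wherever \<open>v\<^sub>r\<close> and \<open>d\<^sub>r\<close> are nonzero, a datum \<open>d\<^sub>r = 0\<close> removes
  the phase from the exit wave, and at \<open>v\<^sub>r = 0\<close> the inherited angle makes the phases equal.
  So the exit waves of the two iterates coincide
  (\<open>surrogate_touches_imp_exit_waves_agree\<close>), and the formula is the gradient of the
  surrogate at its own minimum.
\<close>

section \<open>Parseval's identity and inversion for the two-dimensional Fourier transform\<close>

lemma dft_1d_orthogonality:
  assumes "m > 0" "x < m" "y < m"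
  shows "(\<Sum>a<m. exp (2 * of_real pi * \<i> * of_nat a * (of_nat y - of_nat x) / of_nat m))
    = (if x = y then of_nat m else (0::complex))"
proof (cases "x = y")
  case False
  define q where "q = exp (2 * of_real pi * \<i> * (of_nat y - of_nat x) / of_nat m :: complex)"
  have pow: "exp (2 * of_real pi * \<i> * of_nat a * (of_nat y - of_nat x) / of_nat m) = q ^ a"
    for a
    unfolding q_def exp_of_nat_mult[symmetric] by (simp add: algebra_simps)
  have quot: "q = exp (2 * of_real pi * \<i> * of_nat y / of_nat m)
      / exp (2 * of_real pi * \<i> * of_nat x / of_nat m)"
    unfolding q_def exp_diff[symmetric] by (simp add: diff_divide_distrib right_diff_distrib)
  have "q \<noteq> 1"
    using False complex_root_unity_eq[of m y x] assms unfolding quot by auto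
  moreover have "q ^ m = 1"
  proof -
    have "q ^ m = exp (2 * of_real pi * \<i> * of_nat y) / exp (2 * of_real pi * \<i> * of_nat x)"
      unfolding quot power_divide exp_of_nat_mult[symmetric] using assms by simp
    also have "\<dots> = 1"
      using exp_integer_2pi[of "of_nat y"] exp_integer_2pi[of "of_nat x"]
      by (simp add: mult_ac)
    finally show ?thesis .
  qed
  ultimately show ?thesis
    using False by (simp add: pow geometric_sum)
qed simp

lemma norm_vec_complex_power2:
  fixes v :: "complex ^ 'p::finite"
  shows "(norm v)\<^sup>2 = (\<Sum>r\<in>UNIV. (cmod (v $ r))\<^sup>2)"
  by (simp add: norm_vec_def L2_set_def sum_nonneg)

text \<open>
  The vectorization turns the sum over the index type into a sum over the \<open>m \<times> m\<close> grid,
  on which the summand factors into one character of \<open>\<int>/m\<close> for each coordinate.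
\<close>

lemma dft2_orthogonality:
  fixes g :: "'p::finite \<Rightarrow> nat \<times> nat"
  assumes "m > 0" "vectorization m g"
  defines "e \<equiv> \<lambda>r s. exp (- (2 * of_real pi * \<i> *
       of_nat (fst (g r) * fst (g s) + snd (g r) * snd (g s)) / of_nat m))"
  shows "(\<Sum>r\<in>UNIV. e r s * cnj (e r t)) = (if s = t then (of_nat m)\<^sup>2 else 0)"
proof -
  have bij: "bij_betw g UNIV ({..<m} \<times> {..<m})"
    using assms by (simp add: vectorization_def)
  then have inj: "inj g" and img: "g ` UNIV = {..<m} \<times> {..<m}"
    by (auto simp: bij_betw_def)
  have bounds: "fst (g s) < m" "snd (g s) < m" for s
    using img by (metis SigmaE lessThan_iff prod.sel rangeI)+
  define w where "w x y a = exp (2 * of_real pi * \<i> * of_nat a * (of_nat y - of_nat x) / of_nat m :: complex)"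
    for x y a :: nat
  have "e r s * cnj (e r t) = w (fst (g s)) (fst (g t)) (fst (g r)) * w (snd (g s)) (snd (g t)) (snd (g r))"
    for r
    unfolding e_def w_def exp_cnj exp_add[symmetric] mult_exp_exp
    by (simp add: algebra_simps add_divide_distrib diff_divide_distrib)
  then have "(\<Sum>r\<in>UNIV. e r s * cnj (e r t))
    = (\<Sum>ab\<in>{..<m} \<times> {..<m}. w (fst (g s)) (fst (g t)) (fst ab) * w (snd (g s)) (snd (g t)) (snd ab))"
    using sum.reindex_bij_betw[OF bij, of
      "\<lambda>ab. w (fst (g s)) (fst (g t)) (fst ab) * w (snd (g s)) (snd (g t)) (snd ab)"] by simp
  also have "\<dots> = (\<Sum>a<m. w (fst (g s)) (fst (g t)) a) * (\<Sum>b<m. w (snd (g s)) (snd (g t)) b)"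
    by (simp add: sum_product sum.cartesian_product case_prod_beta)
  also have "\<dots> = (if g s = g t then (of_nat m)\<^sup>2 else 0)"
    unfolding w_def using assms(1) bounds
    by (simp add: dft_1d_orthogonality prod_eq_iff power2_eq_square)
  finally show ?thesis
    using inj by (simp add: inj_eq)
qed

lemma norm_dft2:
  fixes g :: "'p::finite \<Rightarrow> nat \<times> nat" and v :: "complex ^ 'p"
  assumes "m > 0" "vectorization m g"
  shows "(norm (dft2 m g v))\<^sup>2 = (real m)\<^sup>2 * (norm v)\<^sup>2"
proof -
  define e where "e r s = exp (- (2 * of_real pi * \<i> *
       of_nat (fst (g r) * fst (g s) + snd (g r) * snd (g s)) / of_nat m)) " for r s
  have real_m2: "complex_of_real ((real m)\<^sup>2) = (of_nat m)\<^sup>2"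
    by simp
  have "complex_of_real ((norm (dft2 m g v))\<^sup>2)
      = (\<Sum>r\<in>UNIV. (\<Sum>s\<in>UNIV. v $ s * e r s) * cnj (\<Sum>t\<in>UNIV. v $ t * e r t))"
    unfolding norm_vec_complex_power2
    by (simp add: dft2_def e_def complex_norm_square del: of_real_power cnj_sum)
  also have "\<dots> = (\<Sum>r\<in>UNIV. \<Sum>s\<in>UNIV. \<Sum>t\<in>UNIV. v $ s * cnj (v $ t) * (e r s * cnj (e r t)))"
    by (simp add: sum_product mult_ac)
  also have "\<dots> = (\<Sum>s\<in>UNIV. \<Sum>t\<in>UNIV. v $ s * cnj (v $ t) * (\<Sum>r\<in>UNIV. e r s * cnj (e r t)))"
    unfolding sum_distrib_left
    by (subst sum.swap) (intro sum.cong refl sum.swap)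
  also have "\<dots> = (\<Sum>s\<in>UNIV. \<Sum>t\<in>UNIV. if t = s then v $ s * cnj (v $ t) * (of_nat m)\<^sup>2 else 0)"
    unfolding e_def dft2_orthogonality[OF assms] by (intro sum.cong refl) simp
  also have "\<dots> = complex_of_real ((real m)\<^sup>2 * (norm v)\<^sup>2)"
    unfolding norm_vec_complex_power2
    by (simp add: complex_norm_square sum_distrib_left mult_ac real_m2 del: of_real_power)
  finally show ?thesis
    by (simp only: of_real_eq_iff)
qed

lemma linear_dft2: "linear (dft2 m g)"
  by (rule linearI) (simp_all add: dft2_def vec_eq_iff algebra_simps sum.distrib scaleR_sum_right)

text \<open>
  Parseval gives injectivity, and an injective endomorphism of a finite-dimensional space is
  surjective, so no inversion formula has to be computed.
\<close>

lemma dft2_inv_dft2: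
  fixes g :: "'p::finite \<Rightarrow> nat \<times> nat"
  assumes "m > 0" "vectorization m g"
  shows "dft2 m g (inv_dft2 m g v) = v"
proof -
  have "inj (dft2 m g)"
    unfolding linear_injective_0[OF linear_dft2]
  proof (intro allI impI)
    fix v :: "complex ^ 'p"
    assume "dft2 m g v = 0"
    then show "v = 0"
      using norm_dft2[OF assms, of v] assms(1) by simp
  qed
  then have "surj (dft2 m g)"
    using linear_injective_imp_surjective[OF linear_dft2] by blast
  then show ?thesis
    unfolding inv_dft2_def by (rule surj_f_inv_f)
qed

lemma norm_diff_inv_dft2:
  fixes g :: "'p::finite \<Rightarrow> nat \<times> nat"
  assumes "m > 0" "vectorization m g"
  shows "(real m)\<^sup>2 * (norm (v - inv_dft2 m g y))\<^sup>2 = (\<Sum>r\<in>UNIV. (cmod (dft2 m g v $ r - y $ r))\<^sup>2)"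
  using norm_dft2[OF assms, of "v - inv_dft2 m g y"]
  by (simp add: linear_diff[OF linear_dft2] dft2_inv_dft2[OF assms] norm_vec_complex_power2)

section \<open>The gap between the surrogate and the objective\<close>

definition phase :: "real ^ 'p \<Rightarrow> complex ^ 'p \<Rightarrow> complex ^ 'p" where
  "phase psi v = (\<chi> r. exp (\<i> * of_real (angle psi v $ r)))"

lemma norm_phase: "cmod (phase psi v $ r) = 1"
  by (simp add: phase_def)

lemma polar_phase: "v $ r = cmod (v $ r) *\<^sub>R phase psi v $ r"
  by (simp add: phase_def angle_def Arg_eq scaleR_conv_of_real)

text \<open>
  This is what the recursive convention at zeros achieves: an entry that vanishes keeps the
  phase of the preceding iterate.
\<close>

lemma phase_at_zero: "v $ r = 0 \<Longrightarrow> phase (angle psi u) v $ r = phase psi u $ r"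
  by (simp add: phase_def angle_def)

lemma phase_off_zero: "v $ r \<noteq> 0 \<Longrightarrow> phase psi v $ r = phase psi' v $ r"
  by (simp add: phase_def angle_def)

text \<open>
  Both sides are \<open>a\<^sup>2 + b\<^sup>2 - 2 * a * b * (p \<bullet> q)\<close>, because
  \<open>(norm (p - q))\<^sup>2 = 2 - 2 * (p \<bullet> q)\<close>. For \<open>a, b \<ge> 0\<close> this is the reverse triangle
  inequality together with its exact defect.
\<close>

lemma norm_diff_scaled_units:
  fixes p q :: "'a::real_inner"
  assumes "norm p = 1" "norm q = 1"
  shows "(norm (a *\<^sub>R p - b *\<^sub>R q))\<^sup>2 = (a - b)\<^sup>2 + a * b * (norm (p - q))\<^sup>2"
proof -
  have "p \<bullet> p = 1" "q \<bullet> q = 1"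
    using assms by (simp_all add: norm_eq_1)
  then show ?thesis
    unfolding power2_norm_eq_inner
    by (simp add: inner_diff inner_commute[of q p] power2_eq_square algebra_simps)
qed

definition phase_gap :: "complex ^ 'p::finite \<Rightarrow> real ^ 'p \<Rightarrow> complex ^ 'p \<Rightarrow> complex ^ 'p \<Rightarrow> real" where
  "phase_gap v dk p q = (\<Sum>r\<in>UNIV. cmod (v $ r) * sqrt (dk $ r) * (cmod (p $ r - q $ r))\<^sup>2)"

text \<open>
  The first sum on the right depends on the moduli alone: it contains neither the centre \<open>u\<close>
  nor any choice of angles at zeros.
\<close>

lemma residual_decomposition:
  fixes g :: "'p::finite \<Rightarrow> nat \<times> nat"
  assumes "m > 0" "vectorization m g"
  shows "(real m)\<^sup>2 * (norm (Q * w - exit_wave m g Q dk psi u))\<^sup>2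
    = (\<Sum>r\<in>UNIV. (cmod (dft2 m g (Q * w) $ r) - sqrt (dk $ r))\<^sup>2)
      + phase_gap (dft2 m g (Q * w)) dk (phase psi' (dft2 m g (Q * w))) (phase psi (dft2 m g (Q * u)))"
    (is "_ = _ + phase_gap ?v _ ?p ?q")
proof -
  have "(real m)\<^sup>2 * (norm (Q * w - exit_wave m g Q dk psi u))\<^sup>2
    = (\<Sum>r\<in>UNIV. (cmod (?v $ r - sqrt (dk $ r) *\<^sub>R ?q $ r))\<^sup>2)"
    unfolding exit_wave_def norm_diff_inv_dft2[OF assms]
    by (simp add: phase_def scaleR_conv_of_real)
  also have "\<dots> = (\<Sum>r\<in>UNIV. (cmod (cmod (?v $ r) *\<^sub>R ?p $ r - sqrt (dk $ r) *\<^sub>R ?q $ r))\<^sup>2)"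
    by (simp only: polar_phase[symmetric])
  finally show ?thesis
    unfolding norm_diff_scaled_units[OF norm_phase norm_phase] phase_gap_def
    by (simp add: sum.distrib)
qed

lemma phase_gap_nonneg: "(\<And>r. dk $ r \<ge> 0) \<Longrightarrow> phase_gap v dk p q \<ge> 0"
  by (simp add: phase_gap_def sum_nonneg)

text \<open>
  The two phase vectors can differ only at zeros of \<open>v\<close>, where the weight
  \<open>\<bar>v\<^sub>r\<bar>\<close> removes the difference.
\<close>

lemma phase_gap_self: "phase_gap v dk (phase psi' v) (phase psi v) = 0"
  unfolding phase_gap_def
proof (intro sum.neutral ballI)
  fix r
  show "cmod (v $ r) * sqrt (dk $ r) * (cmod (phase psi' v $ r - phase psi v $ r))\<^sup>2 = 0"
    using phase_off_zero[of v r psi' psi] by (cases "v $ r = 0") auto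
qed

lemma residual_majorant:
  fixes g :: "'p::finite \<Rightarrow> nat \<times> nat"
  assumes "m > 0" "vectorization m g"
  shows "(real m)\<^sup>2 * (norm (Q * w - exit_wave m g Q dk psi u))\<^sup>2
    = (real m)\<^sup>2 * (norm (Q * w - exit_wave m g Q dk psi' w))\<^sup>2
      + phase_gap (dft2 m g (Q * w)) dk (phase psi' (dft2 m g (Q * w))) (phase psi (dft2 m g (Q * u)))"
  using residual_decomposition[OF assms, of Q w dk psi u psi']
    residual_decomposition[OF assms, of Q w dk psi' w psi'] by (simp add: phase_gap_self)

text \<open>
  At a zero of the transform the residual is \<open>\<surd>d\<^sub>r\<close> times a unit, whose modulus is the
  same for every angle. This identifies the objective at an iterate, which uses inherited
  angles, with the objective as one fixed function of \<open>w\<close>, which uses the angle 0 and is the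
  one that is differentiated.
\<close>

lemma objective_independent_of_angles:
  fixes g :: "'p::finite \<Rightarrow> nat \<times> nat"
  assumes "m > 0" "vectorization m g"
  shows "objective m g Q N P d psi w = objective m g Q N P d psi' w"
proof -
  have "(norm (Q * (P k *v w) - exit_wave m g Q (d k) (psi k) (P k *v w)))\<^sup>2
      = (norm (Q * (P k *v w) - exit_wave m g Q (d k) (psi' k) (P k *v w)))\<^sup>2" for k
    using residual_majorant[OF assms, of Q "P k *v w" "d k" "psi k" "P k *v w" "psi' k"] assms(1)
    by (simp add: phase_gap_self)
  then show ?thesis
    by (simp only: objective_def)
qed

lemma surrogate_eq_objective_plus_gap:
  fixes g :: "'p::finite \<Rightarrow> nat \<times> nat"
  assumes "m > 0" "vectorization m g"
  shows "surrogate m g Q N P d psi u w = objective m g Q N P d psi' w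
    + (\<Sum>k=1..N. phase_gap (dft2 m g (Q * (P k *v w))) (d k)
        (phase (psi' k) (dft2 m g (Q * (P k *v w)))) (phase (psi k) (dft2 m g (Q * (P k *v u)))))
      / (2 * (real m)\<^sup>2)"
proof -
  have "(norm (Q * (P k *v w) - exit_wave m g Q (d k) (psi k) (P k *v u)))\<^sup>2
     = (norm (Q * (P k *v w) - exit_wave m g Q (d k) (psi' k) (P k *v w)))\<^sup>2
      + phase_gap (dft2 m g (Q * (P k *v w))) (d k)
        (phase (psi' k) (dft2 m g (Q * (P k *v w)))) (phase (psi k) (dft2 m g (Q * (P k *v u))))
        / (real m)\<^sup>2" for k
    using residual_majorant[OF assms, of Q "P k *v w" "d k" "psi k" "P k *v u" "psi' k"] assms(1)
    by (simp add: field_simps)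
  then show ?thesis
    unfolding surrogate_def objective_def
    by (simp add: sum.distrib sum_divide_distrib[symmetric] field_simps)
qed

lemma objective_le_surrogate:
  fixes g :: "'p::finite \<Rightarrow> nat \<times> nat"
  assumes "m > 0" "vectorization m g" "\<And>k r. k \<in> {1..N} \<Longrightarrow> d k $ r \<ge> 0"
  shows "objective m g Q N P d psi' w \<le> surrogate m g Q N P d psi u w"
  unfolding surrogate_eq_objective_plus_gap[OF assms(1,2), of Q N P d psi u w psi']
  using assms(3) by (auto intro!: divide_nonneg_nonneg sum_nonneg phase_gap_nonneg)

text \<open>
  All terms of the gap are nonnegative, so each is zero: off the zeros of \<open>v\<close> either the
  datum vanishes or the phases agree. At the zeros of \<open>v\<close> the gap gives no information, and
  the hypothesis that \<open>psi'\<close> is inherited from \<open>u\<close> takes its place.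
\<close>

lemma surrogate_touches_imp_exit_waves_agree:
  fixes g :: "'p::finite \<Rightarrow> nat \<times> nat"
  assumes "m > 0" "vectorization m g" "\<And>k r. k \<in> {1..N} \<Longrightarrow> d k $ r \<ge> 0"
    and touch: "surrogate m g Q N P d psi u w = objective m g Q N P d psi' w"
    and inherit: "\<And>k. psi' k = angle (psi k) (dft2 m g (Q * (P k *v u)))"
    and k: "k \<in> {1..N}"
  shows "exit_wave m g Q (d k) (psi' k) (P k *v w) = exit_wave m g Q (d k) (psi k) (P k *v u)"
proof -
  define v where "v k = dft2 m g (Q * (P k *v w))" for k
  define p where "p k = phase (psi' k) (v k)" for k
  define q where "q k = phase (psi k) (dft2 m g (Q * (P k *v u)))" for k
  have "(\<Sum>k=1..N. phase_gap (v k) (d k) (p k) (q k)) = 0"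
    using touch surrogate_eq_objective_plus_gap[OF assms(1,2), of Q N P d psi u w psi'] assms(1)
    unfolding v_def p_def q_def by simp
  then have "phase_gap (v k) (d k) (p k) (q k) = 0"
    using k assms(3) by (subst (asm) sum_nonneg_eq_0_iff) (auto intro!: phase_gap_nonneg)
  then have zero: "cmod (v k $ r) * sqrt (d k $ r) * (cmod (p k $ r - q k $ r))\<^sup>2 = 0" for r
    unfolding phase_gap_def using k assms(3) by (subst (asm) sum_nonneg_eq_0_iff) auto
  have "of_real (sqrt (d k $ r)) * p k $ r = of_real (sqrt (d k $ r)) * q k $ r" for r
  proof (cases "v k $ r = 0")
    case True
    then show ?thesis
      by (simp add: p_def q_def inherit phase_at_zero)
  next
    case False
    then show ?thesis
      using zero[of r] by auto
  qed
  then show ?thesis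
    unfolding exit_wave_def p_def q_def v_def phase_def
    by (simp only: vec_lambda_beta)
qed

section \<open>The gradient of the surrogate and stationarity\<close>

text \<open>
  The inner product is the real one, \<open>Re (x * cnj y)\<close> summed over the entries, so moving a
  factor across conjugates it. The entries of a scanning matrix are real, which is why
  \<open>transpose A\<close> appears and not its conjugate.
\<close>

lemma adjoint_masked_scan:
  fixes A :: "complex ^ 'q::finite ^ 'p::finite"
  assumes "scanning_matrix A"
  shows "u \<bullet> (Q * (A *v h)) = (transpose A *v ((\<chi> r. cnj (Q $ r)) * u)) \<bullet> h"
proof -
  have real: "cnj (A $ r $ c) = A $ r $ c" for r c
    using assms unfolding scanning_matrix_def
    by (metis complex_cnj_one complex_cnj_zero insert_iff singletonD)
  have swap: "x \<bullet> (a * y) = (cnj a * x) \<bullet> y" for a x y :: complex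
    by (simp add: inner_complex_def algebra_simps)
  have move: "u $ r \<bullet> (Q $ r * (A $ r $ c * h $ c)) = (A $ r $ c * (cnj (Q $ r) * u $ r)) \<bullet> h $ c"
    for r c
    using swap[of "u $ r" "Q $ r * A $ r $ c" "h $ c"] by (simp add: real mult_ac)
  have "u \<bullet> (Q * (A *v h)) = (\<Sum>r\<in>UNIV. \<Sum>c\<in>UNIV. (A $ r $ c * (cnj (Q $ r) * u $ r)) \<bullet> h $ c)"
    by (simp add: inner_vec_def matrix_vector_mult_def sum_distrib_left inner_sum_right move)
  also have "\<dots> = (\<Sum>c\<in>UNIV. \<Sum>r\<in>UNIV. (A $ r $ c * (cnj (Q $ r) * u $ r)) \<bullet> h $ c)"
    by (rule sum.swap)
  also have "\<dots> = (transpose A *v ((\<chi> r. cnj (Q $ r)) * u)) \<bullet> h"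
    by (simp add: inner_vec_def matrix_vector_mult_def inner_sum_left transpose_def)
  finally show ?thesis .
qed

lemma linear_masked_scan:
  fixes A :: "complex ^ 'q::finite ^ 'p::finite"
  shows "linear (\<lambda>w. Q * (A *v w))"
  by (rule linearI)
    (simp_all add: vec_eq_iff matrix_vector_mult_def algebra_simps sum.distrib scaleR_sum_right sum_distrib_left)

text \<open>
  For a fixed centre the exit waves are constants, so the surrogate is a least-squares
  functional. The vector paired with \<open>h\<close> is the expression that defines the gradient symbol at
  points of nondifferentiability, except that its exit waves are those of the centre \<open>u\<close>.
\<close>

lemma surrogate_has_derivative:
  fixes Q :: "complex ^ 'p::finite" and P :: "nat \<Rightarrow> complex ^ 'q::finite ^ 'p"
  assumes "\<And>k. k \<in> {1..N} \<Longrightarrow> scanning_matrix (P k)"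
  shows "(surrogate m g Q N P d psi u has_derivative
    (\<lambda>h. (\<Sum>k=1..N. transpose (P k) *v ((\<chi> r. cnj (Q $ r)) *
       (Q * (P k *v w) - exit_wave m g Q (d k) (psi k) (P k *v u)))) \<bullet> h)) (at w)"
proof -
  define b where "b k = exit_wave m g Q (d k) (psi k) (P k *v u)" for k
  have L: "((\<lambda>w. Q * (P k *v w)) has_derivative (\<lambda>h. Q * (P k *v h))) (at w)" for k
    by (rule bounded_linear_imp_has_derivative)
      (simp add: linear_conv_bounded_linear[symmetric] linear_masked_scan)
  have "((\<lambda>w. 1 / 2 * (\<Sum>k=1..N. (Q * (P k *v w) - b k) \<bullet> (Q * (P k *v w) - b k))) has_derivative
      (\<lambda>h. 1 / 2 * (\<Sum>k=1..N. (Q * (P k *v w) - b k) \<bullet> (Q * (P k *v h) - 0)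
        + (Q * (P k *v h) - 0) \<bullet> (Q * (P k *v w) - b k)))) (at w)"
    by (intro has_derivative_mult_right has_derivative_sum has_derivative_inner has_derivative_diff L has_derivative_const)
  moreover have "1 / 2 * (\<Sum>k=1..N. (Q * (P k *v w) - b k) \<bullet> (Q * (P k *v h) - 0)
        + (Q * (P k *v h) - 0) \<bullet> (Q * (P k *v w) - b k))
     = (\<Sum>k=1..N. transpose (P k) *v ((\<chi> r. cnj (Q $ r)) * (Q * (P k *v w) - b k))) \<bullet> h" for h
    using assms
    by (simp add: inner_commute[of "Q * (P _ *v h)"] adjoint_masked_scan inner_sum_left
        sum_distrib_left)
  ultimately show ?thesis
    unfolding surrogate_def[abs_def] b_def by (simp add: power2_norm_eq_inner)
qed

lemma derivative_zero_at_global_min: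
  fixes f :: "'a::euclidean_space \<Rightarrow> real"
  assumes "(f has_derivative f') (at x)" "\<And>w. f x \<le> f w"
  shows "f' = (\<lambda>h. 0)"
  using differential_zero_maxmin[of x UNIV f f'] assms by auto

text \<open>
  Two functions are minimal at \<open>x\<close>, namely the majorant \<open>h\<close> and the difference
  \<open>h - f\<close>, so \<open>h' = 0\<close> and \<open>h' = f'\<close>.
\<close>

lemma derivative_zero_below_touching_minimum:
  fixes f h :: "'a::euclidean_space \<Rightarrow> real"
  assumes f: "(f has_derivative f') (at x)" and h: "(h has_derivative h') (at x)"
    and "\<And>w. f w \<le> h w" "f x = h x" "\<And>w. h x \<le> h w"
  shows "f' = (\<lambda>v. 0)"
proof -
  have "h' = (\<lambda>v. 0)"
    using derivative_zero_at_global_min[OF h] assms by blast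
  moreover have "(\<lambda>v. h' v - f' v) = (\<lambda>v. 0)"
    using derivative_zero_at_global_min[OF has_derivative_diff[OF h f]] assms by simp
  ultimately show ?thesis
    by (simp add: fun_eq_iff)
qed

section \<open>Descent of the majorize-minimize iteration\<close>

theorem proposition3p2:
  fixes n m N :: nat
    and g :: "'p::finite \<Rightarrow> nat \<times> nat"
    and Q :: "complex ^ 'p"
    and P :: "nat \<Rightarrow> complex ^ 'q::finite ^ 'p"
    and d :: "nat \<Rightarrow> real ^ 'p"
    and z :: "nat \<Rightarrow> complex ^ 'q"
  assumes "n > 0" "m > 0" "N > 0"
    and "CARD('q) = n\<^sup>2"
    and "vectorization m g"
    and "\<And>k. k \<in> {1..N} \<Longrightarrow> scanning_matrix (P k)"
    and "\<And>k r. k \<in> {1..N} \<Longrightarrow> d k $ r \<ge> 0"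
    and "\<And>j w. surrogate m g Q N P d (zero_angle m g Q P z j) (z j) (z (Suc j))
              \<le> surrogate m g Q N P d (zero_angle m g Q P z j) (z j) w"
  shows "\<forall>j.
      objective m g Q N P d (zero_angle m g Q P z (Suc j)) (z (Suc j))
        \<le> objective m g Q N P d (zero_angle m g Q P z j) (z j) \<and>
      (objective m g Q N P d (zero_angle m g Q P z (Suc j)) (z (Suc j))
         = objective m g Q N P d (zero_angle m g Q P z j) (z j)
       \<longrightarrow> iterate_gradient m g Q N P d z (Suc j) = 0)"
proof (intro allI conjI impI)
  fix j
  let ?psi = "zero_angle m g Q P z"
  let ?S = "surrogate m g Q N P d (?psi j) (z j)"
  have majorant: "objective m g Q N P d psi w \<le> ?S w" for psi w
    using assms(2,5,7) by (intro objective_le_surrogate)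
  have at_centre: "?S (z j) = objective m g Q N P d (?psi j) (z j)"
    by (simp add: surrogate_def objective_def)
  show "objective m g Q N P d (?psi (Suc j)) (z (Suc j)) \<le> objective m g Q N P d (?psi j) (z j)"
    using majorant[of "?psi (Suc j)" "z (Suc j)"] assms(8)[of j "z j"] at_centre by linarith
  assume "objective m g Q N P d (?psi (Suc j)) (z (Suc j)) = objective m g Q N P d (?psi j) (z j)"
  then have touch: "?S (z (Suc j)) = objective m g Q N P d (?psi (Suc j)) (z (Suc j))"
    using majorant[of "?psi (Suc j)" "z (Suc j)"] assms(8)[of j "z j"] at_centre by linarith
  note surrogate_deriv = surrogate_has_derivative[OF assms(6), where w = "z (Suc j)"
      and m = m and g = g and Q = Q and d = d and psi = "?psi j" and u = "z j" and N = N]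
  show "iterate_gradient m g Q N P d z (Suc j) = 0"
  proof (cases "objective m g Q N P d (\<lambda>k. 0) differentiable (at (z (Suc j)))")
    case True
    let ?Phi = "objective m g Q N P d (\<lambda>k. 0)"
    have "?Phi (z (Suc j)) = ?S (z (Suc j))"
      unfolding touch by (rule objective_independent_of_angles[OF assms(2,5)])
    then have "frechet_derivative ?Phi (at (z (Suc j))) = (\<lambda>h. 0)"
      using derivative_zero_below_touching_minimum[OF
          True[unfolded frechet_derivative_works] surrogate_deriv majorant _ assms(8)]
      by blast
    then show ?thesis
      using True by (simp add: iterate_gradient_def complex_gradient_def vec_eq_iff)
  next
    case False
    define G where "G = (\<Sum>k=1..N. transpose (P k) *v ((\<chi> r. cnj (Q $ r)) *
       (Q * (P k *v z (Suc j)) - exit_wave m g Q (d k) (?psi j k) (P k *v z j))))"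
    have "(\<lambda>h. G \<bullet> h) = (\<lambda>h. 0)"
      using derivative_zero_at_global_min[OF surrogate_deriv assms(8)] unfolding G_def by blast
    then have "G = 0"
      by (metis inner_eq_zero_iff)
    moreover have "exit_wave m g Q (d k) (?psi (Suc j) k) (P k *v z (Suc j))
        = exit_wave m g Q (d k) (?psi j k) (P k *v z j)" if "k \<in> {1..N}" for k
      using surrogate_touches_imp_exit_waves_agree[OF assms(2,5,7) touch _ that] by simp
    ultimately show ?thesis
      using False unfolding iterate_gradient_def G_def by simp
  qed
qed

end
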